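(* Fix $\delta\in[0,1)$ and a parameter $\alpha>1$. Let $\phi:[0,1]\to[0,1]$ be the solution of the delay differential equation $$\phi'(t)=\frac{1}{\alpha(1-\delta)}\left[\phi(t)-\phi(t-(1-\delta))\right]\quad\text{for }t\in[1-\delta,1],$$ with initial condition $\phi(t)=\log\left(1+\frac{t}{(\alpha-1)(1-\delta)}\right)$ for $t\in[0,1-\delta]$. Then when $\alpha=\alpha_\delta^*$, $\phi$ is the inverse CDF of the unique optimal strategy for continuous-time ski rental with the $\mathrm{CVaR}_\delta$-competitive ratio.
   Context: Conditional value-at-risk (loss convention): for a real random variable $Y$ and $\delta\in[0,1)$, $\mathrm{CVaR}_\delta[Y]=\inf_{t\in\mathbb{R}}\{t+\frac{1}{1-\delta}\mathbb{E}[(Y-t)^+]\}=\frac{1}{1-\delta}\int_\delta^1F_Y^{-1}(p)\,dp$. For a random variable with support in a bounded interval $[a,b]$, $F^{-1}(p)=\inf\{x\in[a,b]:F(x)\ge p\}$ for $p\in[0,1]$. Continuous-time ski rental (buying cost normalized to $1$): a strategy is a probability distribution $\mu$ on $\mathbb{R}_+$ of the purchase time $X$; for adversary season length $s>0$ the cost is $C(X,s)=s\cdot\mathbb{1}_{X>s}+(X+1)\cdot\mathbb{1}_{X\le s}$. Define $\alpha_\delta^{\mu}(s)=\mathrm{CVaR}_\delta[C(X,s)]/\min\{s,1\}$, $\alpha_\delta^\mu=\sup_{s>0}\alpha_\delta^\mu(s)$, and the optimal ratio $\alpha_\delta^*=\inf_\mu\alpha_\delta^\mu$; a strategy is optimal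 if $\alpha_\delta^\mu=\alpha_\delta^*$. *)

theory Defs
  imports "HOL-Probability.Probability"
begin

text \<open>The expectation of the positive part is a nonnegative Lebesgue integral, so that it is
  \<open>\<infinity>\<close> (and not \<open>0\<close>, as for the Bochner integral) when the positive part is not integrable.\<close>

definition CVaR :: "real \<Rightarrow> 'a measure \<Rightarrow> ('a \<Rightarrow> real) \<Rightarrow> ereal" where
  "CVaR \<delta> M Y =
     (INF t::real. ereal t + ereal (1 / (1 - \<delta>)) * enn2ereal (\<integral>\<^sup>+ \<omega>. ennreal (max 0 (Y \<omega> - t)) \<partial>M))"

text \<open>A strategy is the law of the purchase time; a purchase at time \<open>0\<close> is allowed.\<close>

definition strategies :: "real measure set" where
  "strategies = {\<mu>. prob_space \<mu> \<and> sets \<mu> = sets borel \<and> (AE x in \<mu>. 0 \<le> x)}"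

definition cost :: "real \<Rightarrow> real \<Rightarrow> real" where
  "cost x s = s * of_bool (x > s) + (x + 1) * of_bool (x \<le> s)"

definition ratio_at :: "real \<Rightarrow> real measure \<Rightarrow> real \<Rightarrow> ereal" where
  "ratio_at \<delta> \<mu> s = CVaR \<delta> \<mu> (\<lambda>x. cost x s) / ereal (min s 1)"

text \<open>The ratio of a strategy can be \<open>\<infinity>\<close>, for example for the point mass at \<open>0\<close>.\<close>

definition ratio :: "real \<Rightarrow> real measure \<Rightarrow> ereal" where
  "ratio \<delta> \<mu> = (SUP s\<in>{0<..}. ratio_at \<delta> \<mu> s)"

definition optimal_ratio :: "real \<Rightarrow> ereal" where
  "optimal_ratio \<delta> = (INF \<mu>\<in>strategies. ratio \<delta> \<mu>)"

definition optimal_strategy :: "real \<Rightarrow> real measure \<Rightarrow> bool" where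
  "optimal_strategy \<delta> \<mu> \<longleftrightarrow> \<mu> \<in> strategies \<and> ratio \<delta> \<mu> = optimal_ratio \<delta>"

text \<open>Only meant for a law concentrated on \<open>[a, b]\<close> and for \<open>p \<in> [0, 1]\<close>.\<close>

definition inverse_cdf :: "real \<Rightarrow> real \<Rightarrow> real measure \<Rightarrow> real \<Rightarrow> real" where
  "inverse_cdf a b \<mu> p = Inf {x \<in> {a..b}. cdf \<mu> x \<ge> p}"

text \<open>Only the values of \<open>\<phi>\<close> on \<open>[0, 1]\<close> matter. At \<open>t = 1 - \<delta>\<close> the derivative is one-sided, from
  the right: the derivative of the initial function from the left is in general different. For
  \<open>\<delta> = 0\<close> the interval \<open>[1 - \<delta>, 1]\<close> is a single point and the equation imposes nothing.\<close>

definition solves_dde :: "real \<Rightarrow> real \<Rightarrow> (real \<Rightarrow> real) \<Rightarrow> bool" where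
  "solves_dde \<delta> \<alpha> \<phi> \<longleftrightarrow>
     (\<forall>t\<in>{0..1 - \<delta>}. \<phi> t = ln (1 + t / ((\<alpha> - 1) * (1 - \<delta>)))) \<and>
     (\<forall>t\<in>{1 - \<delta>..1}.
        (\<phi> has_real_derivative 1 / (\<alpha> * (1 - \<delta>)) * (\<phi> t - \<phi> (t - (1 - \<delta>))))
          (at t within {1 - \<delta>..1}))"

end

theory Submission
  imports Defs
begin

text \<open>Let \<open>q\<close> be the quantile function of a strategy, capped at \<open>1\<close>, and \<open>b = 1 - \<delta>\<close>. For season length
  \<open>q t\<close>, the worst \<open>b\<close>-fraction of the costs is attained on quantile levels in a window of length \<open>b\<close>
  ending at \<open>t\<close> (or on \<open>[0, b]\<close> if \<open>t < b\<close>), so a ratio of at most \<open>\<alpha>\<close> amounts to the integral inequality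
  \<open>((\<alpha> - 1) b + min t b) q t \<ge> min t b + \<integral> q\<close> over \<open>[max 0 (t - b), t]\<close>.
  The solution \<open>\<phi>\<close> of the delay equation satisfies it with equality. The kernel is positive, so by a
  Gronwall argument \<open>q \<ge> \<phi>\<close>. Hence \<open>\<phi> 1 \<le> 1\<close> at \<open>\<alpha> = \<alpha>*\<close>, and then \<open>\<phi>\<close> itself has ratio \<open>\<alpha>\<close>; if
  \<open>\<phi> 1 < 1\<close>, a dilated \<open>r \<phi>\<close> would beat \<open>\<alpha>\<close>. So \<open>\<phi> 1 = 1\<close>, which forces \<open>q = \<phi>\<close> near \<open>1\<close> and, moving the
  window backwards, everywhere.\<close>

subsection \<open>The delay equation\<close>

text \<open>Gronwall argument in an exponentially weighted norm. If
  \<open>D t \<ge> - S * exp (l * t)\<close>, integrating this bound over a window gains a factor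
  \<open>1 / l\<close>, so \<open>ineq\<close> gives the same bound with
  \<open>A / c + S / 2\<close> in place of \<open>S\<close>. For the best \<open>S\<close>, which is
  finite, this forces \<open>S \<le> 2 * A / c\<close>.\<close>

lemma window_comparison:
  fixes D k :: "real \<Rightarrow> real"
  assumes c: "0 < c" and b: "0 < b" and A: "0 \<le> A" and x: "0 \<le> x" "x \<le> 1"
    and bdd: "\<And>t. t \<in> {0..x} \<Longrightarrow> \<bar>D t\<bar> \<le> M"
    and int: "D integrable_on {0..x}"
    and k: "\<And>t. t \<in> {0..x} \<Longrightarrow> c \<le> k t"
    and ineq: "\<And>t. t \<in> {0..x} \<Longrightarrow> integral {max 0 (t - b)..t} D - A \<le> k t * D t"
    and t: "t \<in> {0..x}"
  shows "- (2 * A / c * exp (2 / c)) \<le> D t"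
proof -
  \<comment> \<open>Makes \<open>l * c = 2\<close>, so that \<open>S / (l * c)\<close> below is half
    of \<open>S\<close>.\<close>
  define l where "l = 2 / c"
  have l: "l > 0" using c by (simp add: l_def)
  define h where "h = (\<lambda>t. - D t * exp (- l * t))"
  define S where "S = max 0 (SUP t\<in>{0..x}. h t)"
  have S0: "0 \<le> S" by (simp add: S_def)
  have "bdd_above (h ` {0..x})"
  proof (rule bdd_aboveI2)
    fix u assume u: "u \<in> {0..x}"
    have "h u \<le> \<bar>D u\<bar> * exp (- l * u)"
      unfolding h_def by (intro mult_right_mono) auto
    also have "\<dots> \<le> \<bar>D u\<bar> * 1" using u l by (intro mult_left_mono) auto
    also have "\<dots> \<le> M" using bdd[OF u] by simp
    finally show "h u \<le> M" .
  qed
  then have hS: "h u \<le> S" if "u \<in> {0..x}" for u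
    unfolding S_def using that by (meson cSUP_upper max.coboundedI2)
  have DS: "- S * exp (l * u) \<le> D u" if "u \<in> {0..x}" for u
    using hS[OF that] by (simp add: h_def exp_minus field_simps)
  have step: "h u \<le> A / c + S / 2" if u: "u \<in> {0..x}" for u
  proof -
    let ?m = "max 0 (u - b)"
    have sub: "{?m..u} \<subseteq> {0..x}" "{0..u} \<subseteq> {0..x}" using u by auto
    have exp_int: "((\<lambda>v. - S * exp (l * v)) has_integral (- S / l * exp (l * u) - - S / l * exp (l * ?m))) {?m..u}"
      using u b l by (intro fundamental_theorem_of_calculus)
        (auto intro!: derivative_eq_intros simp flip: has_real_derivative_iff_has_vector_derivative)
    have "- S / l * exp (l * u) \<le> integral {?m..u} (\<lambda>v. - S * exp (l * v))"
      unfolding integral_unique[OF exp_int] using S0 l by simp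
    also have "\<dots> \<le> integral {?m..u} D"
      using exp_int integrable_on_subinterval[OF int sub(1)] DS sub(1)
      by (intro integral_le) (auto intro: has_integral_integrable)
    finally have "- (A + S / l * exp (l * u)) \<le> k u * D u" using ineq[OF u] by simp
    then have "k u * (- D u) \<le> A + S / l * exp (l * u)" by simp
    then have "- D u \<le> (A + S / l * exp (l * u)) / c"
    \<comment> \<open>\<open>k u\<close> has only a lower bound, so replacing it by \<open>c\<close>
      needs a positive \<open>- D u\<close>.\<close>
    proof (cases "D u \<ge> 0")
      case True
      moreover have "0 \<le> (A + S / l * exp (l * u)) / c" using A S0 l c by simp
      ultimately show ?thesis by linarith
    next
      case False
      then have "c * (- D u) \<le> k u * (- D u)" using k[OF u] by (intro mult_right_mono) auto
      with \<open>k u * (- D u) \<le> _\<close> show ?thesis using c by (simp add: field_simps)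
    qed
    then have "h u \<le> (A + S / l * exp (l * u)) / c * exp (- l * u)"
      unfolding h_def by (intro mult_right_mono) auto
    also have "\<dots> = A / c * exp (- l * u) + S / (l * c) * (exp (l * u) * exp (- l * u))"
      by (simp add: add_divide_distrib distrib_right)
    also have "exp (l * u) * exp (- l * u) = 1"
      by (simp flip: exp_add)
    also have "l * c = 2" using c by (simp add: l_def)
    also have "A / c * exp (- l * u) + S / 2 * 1 = A / c * exp (- l * u) + S / 2" by simp
    also have "\<dots> \<le> A / c * 1 + S / 2"
      using A c l u by (intro add_right_mono mult_left_mono) auto
    finally show ?thesis by simp
  qed
  have "S \<le> A / c + S / 2"
  proof -
    have "(SUP t\<in>{0..x}. h t) \<le> A / c + S / 2"
      using step x by (intro cSUP_least) auto
    moreover have "0 \<le> A / c + S / 2" using A c S0 by simp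
    ultimately show ?thesis unfolding S_def by simp
  qed
  then have S2: "S \<le> 2 * A / c" by simp
  have "S * exp (l * t) \<le> 2 * A / c * exp l"
    using S2 t x l S0 A c by (intro mult_mono) (auto simp: mult_le_cancel_left1)
  then show ?thesis using DS[OF t] by (simp add: l_def)
qed

section \<open>Solutions of the delay equation: integral form, uniqueness, monotonicity,
  existence\<close>

locale delay =
  fixes \<delta> \<alpha> :: real
  assumes delta: "0 \<le> \<delta>" "\<delta> < 1" and alpha: "1 < \<alpha>"
begin

definition b where "b = 1 - \<delta>"
definition c where "c = (\<alpha> - 1) * b"

lemma b: "0 < b" "b \<le> 1" using delta by (auto simp: b_def)
lemma c: "0 < c" using alpha b by (simp add: c_def)
lemma c_plus_b: "c + b = \<alpha> * b" by (simp add: c_def algebra_simps)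

lemma solves_iff:
  "solves_dde \<delta> \<alpha> f \<longleftrightarrow> (\<forall>t\<in>{0..b}. f t = ln (1 + t / c)) \<and>
     (\<forall>t\<in>{b..1}. (f has_real_derivative 1 / (\<alpha> * b) * (f t - f (t - b))) (at t within {b..1}))"
  by (simp add: solves_dde_def b_def c_def)

lemma solves_continuous:
  assumes f: "solves_dde \<delta> \<alpha> f"
  shows "continuous_on {0..1} f"
proof -
  have "continuous_on {0..b} (\<lambda>t. ln (1 + t / c))"
    using c by (intro continuous_intros) (auto simp: add_nonneg_eq_0_iff)
  then have 1: "continuous_on {0..b} f"
    by (rule continuous_on_cong[THEN iffD1, rotated 2]) (use f solves_iff in auto)
  have 2: "continuous_on {b..1} f"
    using f unfolding solves_iff
    by (intro DERIV_continuous_on) auto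
  have "continuous_on ({0..b} \<union> {b..1}) f"
    by (intro continuous_on_closed_Un 1 2) auto
  moreover have "{0..b} \<union> {b..1} = {0..1}" using b by auto
  ultimately show ?thesis by simp
qed

text \<open>Both regimes are conservation laws, that is, functions with zero derivative: on
  \<open>[0, b]\<close> by the explicit logarithm, on \<open>[b, 1]\<close> by integrating the delay
  equation once. The two constants match at \<open>b\<close> because
  \<open>c + b = \<alpha> * b\<close>.\<close>

lemma solves_integral:
  assumes f: "solves_dde \<delta> \<alpha> f" and t: "t \<in> {0..1}"
  shows "(c + min t b) * f t = min t b + integral {max 0 (t - b)..t} f"
proof -
  note cont = solves_continuous[OF f]
  have init: "f u = ln (1 + u / c)" if "u \<in> {0..b}" for u
    using f that solves_iff by auto
  define P where "P = (\<lambda>t. integral {0..t} f)"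
  have P: "(P has_real_derivative f u) (at u within {0..1})" if "u \<in> {0..1}" for u
    unfolding P_def using that by (intro integral_has_real_derivative cont)
  have fint: "f integrable_on {u..v}" if "0 \<le> u" "v \<le> 1" for u v
    using continuous_on_subset[OF cont] that by (intro integrable_continuous_real) auto
  have early: "(c + u) * f u = u + P u" if u: "u \<in> {0..b}" for u
  proof -
    define G where "G = (\<lambda>t. (c + t) * ln (1 + t / c) - t - P t)"
    have "\<exists>r. \<forall>v\<in>{0..b}. G v = r"
    proof (rule has_field_derivative_zero_constant)
      fix v assume v: "v \<in> {0..b}"
      have "(P has_real_derivative f v) (at v within {0..b})"
        by (rule DERIV_subset[OF P]) (use v b in auto)
      moreover have "1 + v / c > 0" using v c by (simp add: add_pos_nonneg)
      then have "((\<lambda>t. ln (1 + t / c)) has_real_derivative 1 / (c + v)) (at v within {0..b})"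
        using c v by (auto intro!: derivative_eq_intros simp: field_simps)
      ultimately have "(G has_real_derivative (0 + 1) * ln (1 + v / c) + 1 / (c + v) * (c + v) - 1 - f v)
          (at v within {0..b})"
        unfolding G_def
        by (intro DERIV_diff DERIV_mult DERIV_add DERIV_const DERIV_ident)
      then show "(G has_real_derivative 0) (at v within {0..b})"
        using c v by (simp add: init)
    qed simp
    then obtain r where r: "\<And>v. v \<in> {0..b} \<Longrightarrow> G v = r" by auto
    have "G 0 = 0" by (simp add: G_def P_def)
    then have "G u = 0" using r[of 0] r[of u] u by auto
    then show ?thesis using u by (simp add: G_def init)
  qed
  show ?thesis
  proof (cases "t \<le> b")
    case True
    then show ?thesis using early[of t] t by (simp add: P_def)
  next
    case False
    define G where "G = (\<lambda>t. \<alpha> * b * f t - (P t - P (t - b)))"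
    have "\<exists>r. \<forall>v\<in>{b..1}. G v = r"
    proof (rule has_field_derivative_zero_constant)
      fix v assume v: "v \<in> {b..1}"
      have 1: "(P has_real_derivative f v) (at v within {b..1})"
        by (rule DERIV_subset[OF P]) (use v b in auto)
      have "((P \<circ> (\<lambda>v. v - b)) has_real_derivative f (v - b) * 1) (at v within {b..1})"
        by (rule DERIV_image_chain, rule DERIV_subset[OF P])
           (use v b in \<open>auto intro!: derivative_eq_intros\<close>)
      then have 2: "((\<lambda>v. P (v - b)) has_real_derivative f (v - b)) (at v within {b..1})"
        by (simp add: o_def)
      have 3: "(f has_real_derivative 1 / (\<alpha> * b) * (f v - f (v - b))) (at v within {b..1})"
        using f v solves_iff by auto
      show "(G has_real_derivative 0) (at v within {b..1})"
        unfolding G_def using alpha b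
        by (auto intro!: derivative_eq_intros 1 2 3 simp: field_simps)
    qed simp
    then obtain r where r: "\<And>v. v \<in> {b..1} \<Longrightarrow> G v = r" by auto
    have "G b = b" using early[of b] b by (simp add: G_def c_plus_b P_def)
    then have "G t = b" using r[of b] r[of t] t False b by auto
    moreover have "P t - P (t - b) = integral {t - b..t} f"
      unfolding P_def using False t b fint[of 0 t] Henstock_Kurzweil_Integration.integral_combine[of 0 "t - b" t f] by auto
    ultimately show ?thesis using False by (simp add: G_def c_plus_b)
  qed
qed

text \<open>Both functions satisfy the same integral identity, so their difference satisfies the
  inequality of \<open>window_comparison\<close> with equality and \<open>A = 0\<close>. Exchanging
  \<open>f\<close> and \<open>g\<close> then gives uniqueness.\<close>

lemma solves_le:
  assumes f: "solves_dde \<delta> \<alpha> f" and g: "solves_dde \<delta> \<alpha> g" and t: "t \<in> {0..1}"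
  shows "g t \<le> f t"
proof -
  have cont: "continuous_on {0..1} (\<lambda>t. f t - g t)"
    by (intro continuous_intros solves_continuous f g)
  have int: "h integrable_on {max 0 (u - b)..u}" if "continuous_on {0..1} h" "u \<in> {0..1}" for u and h :: "real \<Rightarrow> real"
    using that by (intro integrable_continuous_real continuous_on_subset[OF that(1)]) auto
  obtain M where M: "\<And>t. t \<in> {0..1} \<Longrightarrow> \<bar>f t - g t\<bar> \<le> M"
    using compact_imp_bounded[OF compact_continuous_image[OF cont compact_Icc]]
    unfolding bounded_iff by (metis image_eqI real_norm_def)
  have "- (2 * 0 / c * exp (2 / c)) \<le> f t - g t"
  proof (rule window_comparison[OF c b(1) _ _ _ M integrable_continuous_real[OF cont], where k = "\<lambda>t. c + min t b"])
    fix u :: real assume u: "u \<in> {0..1}"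
    show "c \<le> c + min u b" using u b by auto
    have "integral {max 0 (u - b)..u} (\<lambda>t. f t - g t)
        = integral {max 0 (u - b)..u} f - integral {max 0 (u - b)..u} g"
      by (intro integral_diff int solves_continuous f g u)
    then show "integral {max 0 (u - b)..u} (\<lambda>t. f t - g t) - 0 \<le> (c + min u b) * (f u - g u)"
      using solves_integral[OF f u] solves_integral[OF g u] by (simp add: algebra_simps)
  qed (use t in auto)
  then show ?thesis by simp
qed

lemma solves_unique:
  assumes "solves_dde \<delta> \<alpha> f" "solves_dde \<delta> \<alpha> g" "t \<in> {0..1}"
  shows "g t = f t"
  using solves_le assms by (metis order_antisym)

text \<open>On \<open>[b, 1]\<close> the derivative has the sign of \<open>f t - f (t - b)\<close>.
  At the first point where this gap fails to be positive, \<open>f\<close> would be strictly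
  increasing up to that point, which makes the gap positive there after all.\<close>

lemma solves_strict_mono:
  assumes f: "solves_dde \<delta> \<alpha> f"
  shows "strict_mono_on {0..1} f"
proof -
  note cont = solves_continuous[OF f]
  have init: "f u = ln (1 + u / c)" if "u \<in> {0..b}" for u
    using f that solves_iff by auto
  have smono0: "strict_mono_on {0..b} f"
    using c by (auto intro!: strict_mono_onI simp: init divide_strict_right_mono add_pos_nonneg)
  \<comment> \<open>The gap is required only strictly before \<open>x\<close>: a positive derivative
    in the interior and continuity give strict growth up to \<open>x\<close>, here the first bad
    point.\<close>
  have from_gap: "strict_mono_on {0..x} f"
    if x: "x \<in> {b..1}" and gap: "\<And>t. t \<in> {b..<x} \<Longrightarrow> f (t - b) < f t" for x
  proof -
    have mono1: "f u < f v" if uv: "b \<le> u" "u < v" "v \<le> x" for u v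
    proof (rule DERIV_pos_imp_increasing_open[OF uv(2)])
      fix w assume w: "u < w" "w < v"
      have "(f has_real_derivative 1 / (\<alpha> * b) * (f w - f (w - b))) (at w within {b..1})"
        using f w uv x solves_iff by auto
      moreover have "at w within {b..1} = at w"
        by (rule at_within_Icc_at) (use w uv x in auto)
      moreover have "1 / (\<alpha> * b) * (f w - f (w - b)) > 0"
        using gap[of w] w uv alpha b by simp
      ultimately show "\<exists>y. DERIV f w :> y \<and> 0 < y" by auto
    next
      show "continuous_on {u..v} f" by (rule continuous_on_subset[OF cont]) (use uv x b in auto)
    qed
    show ?thesis
    proof (rule strict_mono_onI)
      fix u v assume uv: "u \<in> {0..x}" "v \<in> {0..x}" "u < v"
      consider "v \<le> b" | "b \<le> u" | "u < b" "b < v" by linarith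
      then show "f u < f v"
      proof cases
        case 1
        then show ?thesis using strict_mono_onD[OF smono0, of u v] uv by auto
      next
        case 2
        then show ?thesis using mono1 uv by auto
      next
        case 3
        then have "f u < f b" using strict_mono_onD[OF smono0, of u b] uv by auto
        also have "f b < f v" using mono1 3 uv by auto
        finally show ?thesis .
      qed
    qed
  qed
  have gap: "f (t - b) < f t" if t: "t \<in> {b..1}" for t
  proof (rule ccontr)
    assume neg: "\<not> f (t - b) < f t"
    define S where "S = {u \<in> {b..1}. f u - f (u - b) \<le> 0}"
    have "continuous_on {b..1} (\<lambda>u. f (u - b))"
      by (rule continuous_on_compose2[OF cont]) (use b in \<open>auto intro!: continuous_intros\<close>)
    then have "continuous_on {b..1} (\<lambda>u. f u - f (u - b))"
      using b by (intro continuous_intros continuous_on_subset[OF cont]) auto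
    then have "closed S"
      unfolding S_def by (intro continuous_on_closed_Collect_le) auto
    moreover have bdd: "bdd_below S" unfolding S_def by (auto intro: bdd_belowI[of _ b])
    moreover have ne: "S \<noteq> {}" using neg t by (auto simp: S_def)
    ultimately have inS: "Inf S \<in> S" by (intro closed_contains_Inf)
    have before: "f (u - b) < f u" if "u \<in> {b..<Inf S}" for u
    proof (rule ccontr)
      assume "\<not> f (u - b) < f u"
      then have "u \<in> S" using that inS by (auto simp: S_def)
      then have "Inf S \<le> u" using bdd by (intro cInf_lower)
      then show False using that by auto
    qed
    have "strict_mono_on {0..Inf S} f"
      using inS by (intro from_gap before) (auto simp: S_def)
    then have "f (Inf S - b) < f (Inf S)"
      by (rule strict_mono_onD) (use inS b in \<open>auto simp: S_def\<close>)
    then show False using inS by (auto simp: S_def)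
  qed
  show ?thesis
    using from_gap[of 1] gap b by auto
qed

text \<open>Method of steps: iterate \<open>n\<close> is correct on \<open>[0, (n + 1) b]\<close>. The clipping by \<open>min\<close> and \<open>max\<close>
  makes every iterate agree with the initial function on \<open>[0, b]\<close>.\<close>

primrec iter :: "nat \<Rightarrow> real \<Rightarrow> real" where
  "iter 0 t = ln (1 + min t b / c)"
| "iter (Suc n) t = ln (1 + min t b / c) - ln (1 + b / c)
     + exp (max 0 (t - b) / (\<alpha> * b)) * (ln (1 + b / c)
       - 1 / (\<alpha> * b) * integral {0..max 0 (t - b)} (\<lambda>v. exp (- v / (\<alpha> * b)) * iter n v))"

lemma iter_continuous: "continuous_on {0..1} (iter n)"
proof (induction n)
  case 0
  have "1 + min t b / c \<noteq> 0" if "0 \<le> t" for t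
  proof -
    have "0 \<le> min t b / c" using that b c by simp
    then show ?thesis by linarith
  qed
  then show ?case using c by (auto intro!: continuous_intros)
next
  case (Suc n)
  have nz: "1 + min t b / c \<noteq> 0" if "0 \<le> t" for t
  proof -
    have "0 \<le> min t b / c" using that b c by simp
    then show ?thesis by linarith
  qed
  have "continuous_on {0..1} (\<lambda>v. exp (- v / (\<alpha> * b)) * iter n v)"
    using alpha b by (auto intro!: continuous_intros Suc)
  then have "continuous_on {0..1} (\<lambda>x. integral {0..x} (\<lambda>v. exp (- v / (\<alpha> * b)) * iter n v))"
    by (intro indefinite_integral_continuous_1 integrable_continuous_real)
  then have "continuous_on {0..1} (\<lambda>t. integral {0..max 0 (t - b)} (\<lambda>v. exp (- v / (\<alpha> * b)) * iter n v))"
    by (rule continuous_on_compose2) (use b in \<open>auto intro!: continuous_intros\<close>)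
  moreover have "continuous_on {0..1} (\<lambda>t. ln (1 + min t b / c))"
    using c nz by (intro continuous_intros ballI) auto
  ultimately show ?case
    using alpha b by (auto intro!: continuous_intros)
qed

text \<open>Iterate \<open>Suc n\<close> at \<open>t\<close> reads iterate \<open>n\<close> only on
  \<open>[0, t - b]\<close>, so each iteration extends the agreement by one window length.\<close>

lemma iter_stable:
  assumes "0 \<le> t" "t \<le> real (Suc n) * b"
  shows "iter (Suc n) t = iter n t"
  using assms
proof (induction n arbitrary: t)
  case 0
  then show ?case by (simp add: max_absorb1)
next
  case (Suc n)
  have "integral {0..max 0 (t - b)} (\<lambda>v. exp (- v / (\<alpha> * b)) * iter (Suc n) v)
      = integral {0..max 0 (t - b)} (\<lambda>v. exp (- v / (\<alpha> * b)) * iter n v)"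
  proof (rule Henstock_Kurzweil_Integration.integral_cong)
    fix v assume "v \<in> {0..max 0 (t - b)}"
    moreover have "0 \<le> real (Suc n) * b" using b by simp
    moreover have "t - b \<le> real (Suc n) * b" using Suc.prems(2) by (simp add: algebra_simps)
    ultimately have "0 \<le> v" "v \<le> real (Suc n) * b" by auto
    then show "exp (- v / (\<alpha> * b)) * iter (Suc n) v = exp (- v / (\<alpha> * b)) * iter n v"
      using Suc.IH by simp
  qed
  then show ?case by (simp only: iter.simps)
qed

text \<open>The recursion of \<open>iter\<close> is the variation of constants formula with
  integrating factor \<open>exp (- t / (\<alpha> * b))\<close>, the delayed term being taken from
  the previous iterate. After finitely many steps two consecutive iterates agree on
  \<open>[0, 1]\<close>, so the delayed term is the function's own.\<close>

lemma solution_exists: "\<exists>f. solves_dde \<delta> \<alpha> f"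
proof -
  obtain n :: nat where n: "1 / b \<le> real n" using real_arch_simple by blast
  then have n1: "1 \<le> real (Suc n) * b" using b by (simp add: field_simps)
  let ?f = "iter (Suc n)"
  have stable: "iter n t = ?f t" if "t \<in> {0..1}" for t
    using iter_stable[of t n] that n1 by auto
  define J where "J = (\<lambda>x. integral {0..x} (\<lambda>v. exp (- v / (\<alpha> * b)) * iter n v))"
  have f_late: "?f t = exp ((t - b) / (\<alpha> * b)) * (ln (1 + b / c) - 1 / (\<alpha> * b) * J (t - b))"
    if "t \<in> {b..1}" for t
    using that by (simp add: max_absorb2 min_absorb2 J_def)
  have "solves_dde \<delta> \<alpha> ?f"
    unfolding solves_iff
  proof (intro conjI ballI)
    fix t assume "t \<in> {0..b}"
    then show "?f t = ln (1 + t / c)" by (simp add: max_absorb1 min_absorb1)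
  next
    fix t assume t: "t \<in> {b..1}"
    have "(J has_real_derivative exp (- (t - b) / (\<alpha> * b)) * iter n (t - b)) (at (t - b) within {0..1})"
      unfolding J_def using t b alpha
      by (intro integral_has_real_derivative continuous_intros iter_continuous) auto
    then have "((J \<circ> (\<lambda>v. v - b)) has_real_derivative exp (- (t - b) / (\<alpha> * b)) * iter n (t - b) * 1)
        (at t within {b..1})"
      by (intro DERIV_image_chain, elim DERIV_subset)
         (use t b in \<open>auto intro!: derivative_eq_intros\<close>)
    then have J': "((\<lambda>v. J (v - b)) has_real_derivative exp (- (t - b) / (\<alpha> * b)) * iter n (t - b))
        (at t within {b..1})" by (simp add: o_def)
    let ?g = "\<lambda>t. exp ((t - b) / (\<alpha> * b)) * (ln (1 + b / c) - 1 / (\<alpha> * b) * J (t - b))"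
    have ab: "\<alpha> * b \<noteq> 0" using alpha b by simp
    have ee: "exp ((t - b) / (\<alpha> * b)) * exp (- (t - b) / (\<alpha> * b)) = 1"
      by (simp flip: exp_add add_divide_distrib)
    have "(?g has_real_derivative exp ((t - b) / (\<alpha> * b)) * (1 / (\<alpha> * b)) * (ln (1 + b / c) - 1 / (\<alpha> * b) * J (t - b))
        + exp ((t - b) / (\<alpha> * b)) * (0 - 1 / (\<alpha> * b) * (exp (- (t - b) / (\<alpha> * b)) * iter n (t - b)))) (at t within {b..1})"
      using ab by (auto intro!: derivative_eq_intros J')
    also have "exp ((t - b) / (\<alpha> * b)) * (1 / (\<alpha> * b)) * (ln (1 + b / c) - 1 / (\<alpha> * b) * J (t - b))
        + exp ((t - b) / (\<alpha> * b)) * (0 - 1 / (\<alpha> * b) * (exp (- (t - b) / (\<alpha> * b)) * iter n (t - b)))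
      = 1 / (\<alpha> * b) * ?g t
        - 1 / (\<alpha> * b) * ((exp ((t - b) / (\<alpha> * b)) * exp (- (t - b) / (\<alpha> * b))) * iter n (t - b))"
      by (simp add: algebra_simps)
    also have "\<dots> = 1 / (\<alpha> * b) * (?g t - iter n (t - b))"
      unfolding ee by (simp add: algebra_simps)
    finally have "(?g has_real_derivative 1 / (\<alpha> * b) * (?g t - iter n (t - b))) (at t within {b..1})" .
    moreover have "?g t - iter n (t - b) = ?f t - ?f (t - b)"
      using t b by (simp only: f_late[OF t] stable[of "t - b", symmetric]) (simp add: stable)
    ultimately have "(?g has_real_derivative 1 / (\<alpha> * b) * (?f t - ?f (t - b))) (at t within {b..1})"
      by simp
    then show "(?f has_real_derivative 1 / (\<alpha> * b) * (?f t - ?f (t - b))) (at t within {b..1})"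
      by (rule has_field_derivative_transform_within[OF _ zero_less_one t]) (simp only: f_late)
  qed
  then show ?thesis by blast
qed

end

subsection \<open>The ratio in terms of quantile functions\<close>

abbreviation unit_uniform :: "real measure" where
  "unit_uniform \<equiv> restrict_space lborel {0<..<1}"

definition quantile :: "real measure \<Rightarrow> real \<Rightarrow> real" where
  "quantile \<mu> u = Inf {x. u \<le> cdf \<mu> x}"

text \<open>The cap makes the function bounded, hence integrable over windows, and fits the
  denominator \<open>min s 1\<close> of the ratio. The value \<open>0\<close> at level
  \<open>0\<close> agrees with \<open>\<phi> 0 = 0\<close>.\<close>

definition capped_quantile :: "real measure \<Rightarrow> real \<Rightarrow> real" where
  "capped_quantile \<mu> u = (if u \<in> {0<..<1} then min (quantile \<mu> u) 1 else 0)"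

lemma cost_eq: "cost x s = (if x \<le> s then x + 1 else s)"
  by (simp add: cost_def)

lemma cost_measurable [measurable]: "(\<lambda>x. cost x s) \<in> borel_measurable borel"
  unfolding cost_eq by measurable

lemma prob_space_unit_uniform: "prob_space unit_uniform"
  by (auto simp: emeasure_restrict_space space_restrict_space intro!: prob_spaceI)

lemma continuous_measurable_unit_uniform:
  assumes "continuous_on {0..1} f"
  shows "f \<in> borel_measurable unit_uniform"
proof -
  have "f \<in> borel_measurable (restrict_space borel {0<..<1})"
    by (intro borel_measurable_continuous_on_restrict continuous_on_subset[OF assms]) auto
  then show ?thesis
    by (simp add: measurable_def space_restrict_space sets_restrict_space)
qed

lemma nn_integral_distr_unit_uniform:
  assumes "f \<in> borel_measurable unit_uniform" and "g \<in> borel_measurable borel"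
  shows "(\<integral>\<^sup>+ x. g x \<partial>distr unit_uniform borel f) = (\<integral>\<^sup>+ u. g (f u) * indicator {0<..<1} u \<partial>lborel)"
  using assms by (subst nn_integral_distr) (auto intro!: nn_integral_restrict_space)

text \<open>The infimum in \<open>CVaR\<close> is bounded by one threshold \<open>\<tau>\<close>.
  Season \<open>s\<close> is matched with a level \<open>t\<close>: levels up to \<open>t\<close>
  buy and cost \<open>1 + q u\<close>, the others rent and cost \<open>s\<close>. Only levels in the
  window ending at \<open>t\<close> exceed \<open>\<tau>\<close>, and the inequality assumed for
  \<open>q\<close> becomes \<open>\<tau> + I / b \<le> A * q t\<close>.\<close>

lemma ratio_distr_le:
  fixes q :: "real \<Rightarrow> real"
  assumes delta: "0 \<le> \<delta>" "\<delta> < 1" and A: "0 \<le> A"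
    and cont: "continuous_on {0..1} q" and mono: "strict_mono_on {0..1} q"
    and q0: "q 0 = 0" and q1: "q 1 \<le> 1"
    and ineq: "\<And>t. t \<in> {0<..1} \<Longrightarrow> min t (1 - \<delta>) + integral {max 0 (t - (1 - \<delta>))..t} q
        \<le> ((A - 1) * (1 - \<delta>) + min t (1 - \<delta>)) * q t"
  shows "ratio \<delta> (distr unit_uniform borel q) \<le> ereal A"
  unfolding ratio_def
proof (rule SUP_least)
  fix s :: real assume "s \<in> {0<..}"
  then have s: "0 < s" by simp
  define b where "b = 1 - \<delta>"
  have b: "0 < b" "b \<le> 1" using delta by (auto simp: b_def)
  have q_mono: "q u \<le> q v" if "0 \<le> u" "u \<le> v" "v \<le> 1" for u v
    using strict_mono_on_leD[OF mono] that by auto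
  obtain t where t: "t \<in> {0<..1}" "q t \<le> min s 1" and below: "\<And>u. u \<in> {0<..<1} \<Longrightarrow> q u \<le> s \<longleftrightarrow> u \<le> t"
    and t_eq: "t < 1 \<Longrightarrow> s = q t"
  proof (cases "q 1 \<le> s")
    case True
    have "q u \<le> s \<longleftrightarrow> u \<le> 1" if "u \<in> {0<..<1}" for u
      using that q_mono[of u 1] True by auto
    then show ?thesis using True q1 that[of 1] by auto
  next
    case False
    obtain t where t: "0 \<le> t" "t \<le> 1" "q t = s"
      using IVT'[of q 0 s 1] cont s q0 False by auto
    have "t \<noteq> 0" using t s q0 by auto
    moreover have "q u \<le> s \<longleftrightarrow> u \<le> t" if "u \<in> {0<..<1}" for u
      using strict_mono_on_less_eq[OF mono, of u t] t that by auto
    ultimately show ?thesis using t q_mono[of t 1] q1 that[of t] by auto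
  qed
  define l where "l = max 0 (t - b)"
  have l: "0 \<le> l" "l \<le> t" using t b by (auto simp: l_def)
  \<comment> \<open>The lowest cost in the worst \<open>b\<close>-fraction: for
    \<open>t \<le> b\<close> this fraction takes in all buying levels and is filled up by renting
    ones of cost \<open>q t\<close>; otherwise it consists of the buying levels from
    \<open>t - b\<close> on.\<close>
  define \<tau> where "\<tau> = (if t \<le> b then q t else 1 + q (t - b))"
  define I where "I = integral {l..t} (\<lambda>u. 1 + q u - \<tau>)"
  have qint: "q integrable_on {l..t}"
    using l t by (intro integrable_continuous_real continuous_on_subset[OF cont]) auto
  then have "((\<lambda>u. 1 + q u - \<tau>) has_integral I) {l..t}"
    unfolding I_def by (intro integrable_integral integrable_diff integrable_add) auto
  moreover have q_nonneg: "0 \<le> q u" if "u \<in> {0..1}" for u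
    using q_mono[of 0 u] q0 that by auto
  have pos: "0 \<le> 1 + q u - \<tau>" if "u \<in> {l..t}" for u
  proof (cases "t \<le> b")
    case True
    then show ?thesis
      using that t l q1 q_mono[of t 1] q_nonneg[of u] by (auto simp: \<tau>_def)
  next
    case False
    then show ?thesis
      using that t l q_mono[of "t - b" u] by (auto simp: \<tau>_def l_def)
  qed
  ultimately have nnI: "(\<integral>\<^sup>+ u. ennreal (1 + q u - \<tau>) * indicator {l..t} u \<partial>lborel) = ennreal I"
    by (intro nn_integral_has_integral_lebesgue')
  have I0: "0 \<le> I" unfolding I_def using pos
    by (intro Henstock_Kurzweil_Integration.integral_nonneg integrable_diff integrable_add qint) auto
  have I_eq: "I = (t - l) * (1 - \<tau>) + integral {l..t} q"
  proof -
    have "I = integral {l..t} (\<lambda>u. (1 - \<tau>) + q u)" unfolding I_def by (simp add: algebra_simps)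
    also have "\<dots> = integral {l..t} (\<lambda>u. 1 - \<tau>) + integral {l..t} q"
      by (rule integral_add) (use qint in auto)
    finally show ?thesis using l by simp
  qed
  \<comment> \<open>Buying levels left of the window cost at most \<open>\<tau>\<close>, and a
    renting level costs \<open>q t \<le> \<tau>\<close>, so both drop out.\<close>
  have point: "ennreal (max 0 (cost (q u) s - \<tau>)) * indicator {0<..<1} u
      \<le> ennreal (1 + q u - \<tau>) * indicator {l..t} u" for u
  proof (cases "u \<in> {0<..<1}")
    case True
    show ?thesis
    proof (cases "u \<le> t")
      case ut: True
      then have cost: "cost (q u) s = 1 + q u" using below[OF True] by (simp add: cost_eq)
      show ?thesis
      proof (cases "l \<le> u")
        case True
        then show ?thesis using ut pos[of u] \<open>u \<in> {0<..<1}\<close> by (simp add: cost max_absorb2)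
      next
        case False
        then have "t > b" "u \<le> t - b" using \<open>u \<in> {0<..<1}\<close> by (auto simp: l_def split: if_splits)
        then have "cost (q u) s - \<tau> \<le> 0"
          using q_mono[of u "t - b"] True t b by (auto simp: \<tau>_def cost)
        then show ?thesis by (simp add: max_absorb1)
      qed
    next
      case False
      then have "cost (q u) s = s" using below[OF True] by (simp add: cost_eq)
      moreover have "s = q t" using t_eq False True by auto
      moreover have "q t \<le> \<tau>"
        using t q1 q_mono[of t 1] q_nonneg[of "t - b"] b by (auto simp: \<tau>_def)
      ultimately show ?thesis by (simp add: max_absorb1)
    qed
  qed simp
  have "(\<integral>\<^sup>+ x. ennreal (max 0 (cost x s - \<tau>)) \<partial>distr unit_uniform borel q)
      = (\<integral>\<^sup>+ u. ennreal (max 0 (cost (q u) s - \<tau>)) * indicator {0<..<1} u \<partial>lborel)"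
    by (rule nn_integral_distr_unit_uniform[OF continuous_measurable_unit_uniform[OF cont]]) measurable
  also have "\<dots> \<le> ennreal I"
    unfolding nnI[symmetric] by (intro nn_integral_mono point)
  finally have N: "enn2ereal (\<integral>\<^sup>+ x. ennreal (max 0 (cost x s - \<tau>)) \<partial>distr unit_uniform borel q) \<le> ereal I"
    using I0 by (metis enn2ereal_ennreal less_eq_ennreal.rep_eq)
  have "\<tau> + I / b \<le> A * q t"
  proof -
    have "min t b + integral {l..t} q \<le> ((A - 1) * b + min t b) * q t"
      using ineq[OF t(1)] by (simp add: l_def b_def)
    then have "b * \<tau> + I \<le> b * (A * q t)"
      unfolding I_eq \<tau>_def l_def using t by (auto simp: algebra_simps max_def min_def split: if_splits)
    then show ?thesis using b by (simp add: field_simps)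
  qed
  have "CVaR \<delta> (distr unit_uniform borel q) (\<lambda>x. cost x s)
      \<le> ereal \<tau> + ereal (1 / b) * enn2ereal (\<integral>\<^sup>+ x. ennreal (max 0 (cost x s - \<tau>)) \<partial>distr unit_uniform borel q)"
    unfolding CVaR_def b_def by (rule INF_lower) simp
  also have "\<dots> \<le> ereal \<tau> + ereal (1 / b) * ereal I"
    using b by (intro add_left_mono ereal_mult_left_mono N) auto
  also have "\<dots> = ereal (\<tau> + I / b)" by simp
  also have "\<dots> \<le> ereal (A * q t)" using \<open>\<tau> + I / b \<le> A * q t\<close> by simp
  also have "\<dots> \<le> ereal (min s 1) * ereal A"
    using mult_left_mono[OF t(2) A] by (simp add: mult.commute flip: ereal_min)
  finally show "ratio_at \<delta> (distr unit_uniform borel q) s \<le> ereal A"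
    unfolding ratio_at_def using s by (subst ereal_divide_le_pos) (auto simp flip: ereal_min)
qed

lemma distr_in_strategies:
  assumes "f \<in> borel_measurable unit_uniform" and "\<And>u. u \<in> {0<..<1} \<Longrightarrow> 0 \<le> f u"
  shows "distr unit_uniform borel f \<in> strategies"
proof -
  interpret prob_space unit_uniform by (rule prob_space_unit_uniform)
  have "AE x in distr unit_uniform borel f. 0 \<le> x"
    using assms by (subst AE_distr_iff) (auto simp: space_restrict_space intro!: AE_I2)
  then show ?thesis
    unfolding strategies_def using assms by (auto intro!: prob_space_distr)
qed

lemma bounded_measurable_integrable_on:
  fixes f :: "real \<Rightarrow> real"
  assumes "f \<in> borel_measurable borel" "\<And>u. \<bar>f u\<bar> \<le> M" "S \<in> sets borel" "S \<subseteq> {x..y}"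
  shows "f integrable_on S"
proof (rule set_borel_integral_eq_integral)
  have "emeasure lborel S \<le> emeasure lborel {x..y}" using assms by (intro emeasure_mono) auto
  also have "\<dots> < \<infinity>" by (simp add: emeasure_lborel_Icc_eq)
  finally show "set_integrable lborel S f"
    unfolding set_integrable_def using assms by (intro integrableI_bounded_set_indicator[where B = M]) auto
qed

section \<open>Quantile functions of arbitrary strategies\<close>

context
  fixes \<mu> :: "real measure"
  assumes strategy: "\<mu> \<in> strategies"
begin

interpretation cdf_distribution \<mu>
proof -
  have "prob_space \<mu>" and sets: "sets \<mu> = sets borel"
    using strategy by (simp_all add: strategies_def)
  moreover have "space \<mu> = UNIV" using sets_eq_imp_space_eq[OF sets] by simp
  ultimately show "cdf_distribution \<mu>"
    by (simp add: cdf_distribution_def real_distribution_def real_distribution_axioms_def)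
qed

lemma quantile_le_iff: "u \<in> {0<..<1} \<Longrightarrow> quantile \<mu> u \<le> x \<longleftrightarrow> u \<le> cdf \<mu> x"
  unfolding quantile_def by (subst pseudoinverse[symmetric]) auto

lemma quantile_mono: "u \<in> {0<..<1} \<Longrightarrow> v \<in> {0<..<1} \<Longrightarrow> u \<le> v \<Longrightarrow> quantile \<mu> u \<le> quantile \<mu> v"
  unfolding quantile_def by (rule mono_onD[OF mono_I])

lemma quantile_nonneg:
  assumes "u \<in> {0<..<1}"
  shows "0 \<le> quantile \<mu> u"
proof (rule ccontr)
  assume neg: "\<not> 0 \<le> quantile \<mu> u"
  have "AE x in \<mu>. 0 \<le> x" using strategy by (simp add: strategies_def)
  then have "AE x in \<mu>. x \<notin> {..quantile \<mu> u}"
    by eventually_elim (use neg in auto)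
  then have "cdf \<mu> (quantile \<mu> u) = 0"
    unfolding cdf_def by (subst prob_eq_0) auto
  then show False using quantile_le_iff[OF assms, of "quantile \<mu> u"] assms by auto
qed

lemma quantile_measurable: "quantile \<mu> \<in> borel_measurable unit_uniform"
proof -
  have "quantile \<mu> \<in> borel_measurable (restrict_space borel {0<..<1})"
    unfolding quantile_def by (rule measurable_CI)
  then show ?thesis
    by (simp add: measurable_def space_restrict_space sets_restrict_space)
qed

text \<open>Inverse transform sampling: a law is recovered from its quantile function.\<close>

lemma distr_quantile: "distr unit_uniform borel (quantile \<mu>) = \<mu>"
  unfolding quantile_def by (rule distr_I_eq_M)

lemma capped_quantile_bounds: "0 \<le> capped_quantile \<mu> u" "capped_quantile \<mu> u \<le> 1"
  using quantile_nonneg[of u] by (auto simp: capped_quantile_def)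

lemma capped_quantile_mono:
  "0 \<le> u \<Longrightarrow> u \<le> v \<Longrightarrow> v < 1 \<Longrightarrow> capped_quantile \<mu> u \<le> capped_quantile \<mu> v"
  using quantile_mono[of u v] capped_quantile_bounds[of v] by (auto simp: capped_quantile_def)

lemma capped_quantile_measurable [measurable]: "capped_quantile \<mu> \<in> borel_measurable borel"
proof -
  have "(\<lambda>u. min (quantile \<mu> u) 1) \<in> borel_measurable unit_uniform"
    using quantile_measurable by measurable
  then have "(\<lambda>u. indicator {0<..<1} u *\<^sub>R min (quantile \<mu> u) 1) \<in> borel_measurable lborel"
    by (subst (asm) borel_measurable_restrict_space_iff) auto
  moreover have "capped_quantile \<mu> = (\<lambda>u. indicator {0<..<1} u *\<^sub>R min (quantile \<mu> u) 1)"
    by (auto simp: capped_quantile_def fun_eq_iff)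
  ultimately show ?thesis by simp
qed

lemma capped_quantile_integrable: "capped_quantile \<mu> integrable_on {x..y}"
proof (rule bounded_measurable_integrable_on)
  show "\<bar>capped_quantile \<mu> u\<bar> \<le> 1" for u
    using capped_quantile_bounds[of u] by simp
qed auto

text \<open>The necessary counterpart of \<open>ratio_distr_le\<close>: for every threshold, the
  objective in \<open>CVaR\<close> is at least the average of the cost over any set of levels of
  measure \<open>1 - \<delta>\<close>. This is applied to a window containing \<open>t\<close>, with
  \<open>s\<close> decreasing to the quantile at \<open>t\<close>.\<close>

lemma capped_quantile_ineq:
  assumes delta: "0 \<le> \<delta>" "\<delta> < 1" and ratio: "ratio \<delta> \<mu> \<le> ereal A" and t: "t \<in> {0..<1}"
  shows "min t (1 - \<delta>) + integral {max 0 (t - (1 - \<delta>))..t} (capped_quantile \<mu>)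
    \<le> ((A - 1) * (1 - \<delta>) + min t (1 - \<delta>)) * capped_quantile \<mu> t"
proof (cases "t = 0")
  case True
  then show ?thesis using delta by (simp add: capped_quantile_def)
next
  case False
  then have t01: "t \<in> {0<..<1}" using t by auto
  define b where "b = 1 - \<delta>"
  have b: "0 < b" "b \<le> 1" using delta by (auto simp: b_def)
  \<comment> \<open>The window \<open>[l, r]\<close> always has length \<open>b\<close>; for
    \<open>t < b\<close> it is completed by levels above \<open>t\<close>.\<close>
  define l where "l = max 0 (t - b)"
  define r where "r = max t b"
  have lr: "0 \<le> l" "l \<le> t" "t \<le> r" "r \<le> 1" "r - l = b" "t - l = min t b"
    using t01 b by (auto simp: l_def r_def)
  define J where "J = integral {l..t} (capped_quantile \<mu>)"
  \<comment> \<open>Taking \<open>s\<close> strictly above the quantile guarantees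
    \<open>s > 0\<close> even if the quantile is \<open>0\<close>.\<close>
  have at_s: "min t b + J \<le> ((A - 1) * b + min t b) * min s 1" if s: "quantile \<mu> t < s" for s
  proof -
    have s0: "0 < s" using s quantile_nonneg[OF t01] by simp
    \<comment> \<open>A lower bound of the cost: a level above \<open>t\<close> either rents and
      pays \<open>s\<close>, or buys and pays at least \<open>1\<close>.\<close>
    define g where "g = (\<lambda>u. if u \<le> t then 1 + capped_quantile \<mu> u else min s 1)"
    have g_meas [measurable]: "g \<in> borel_measurable borel" unfolding g_def by measurable
    have g_bdd: "\<bar>g u\<bar> \<le> 2" for u
      using capped_quantile_bounds[of u] s0 by (auto simp: g_def)
    have g_cost: "g u \<le> cost (quantile \<mu> u) s" if "u \<in> {0<..<1}" for u
    proof (cases "u \<le> t")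
      case True
      then have "quantile \<mu> u \<le> s" using quantile_mono[OF that t01] s by auto
      then show ?thesis using True that by (auto simp: cost_eq g_def capped_quantile_def)
    next
      case False
      then show ?thesis using quantile_nonneg[OF that] by (auto simp: cost_eq g_def)
    qed
    define W where "W = integral {l..r} g"
    have gint: "g integrable_on {l..r}"
      by (rule bounded_measurable_integrable_on[OF g_meas g_bdd]) auto
    have W: "W = min t b + J + min s 1 * (b - min t b)"
    proof -
      have "W = integral {l..t} g + integral {t..r} g"
        unfolding W_def using lr gint by (simp add: Henstock_Kurzweil_Integration.integral_combine)
      also have "integral {l..t} g = integral {l..t} (\<lambda>u. 1 + capped_quantile \<mu> u)"
        by (rule Henstock_Kurzweil_Integration.integral_cong) (auto simp: g_def)
      also have "\<dots> = integral {l..t} (\<lambda>u. 1) + J"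
        unfolding J_def by (rule integral_add) (auto intro: capped_quantile_integrable)
      also have "integral {t..r} g = integral {t..r} (\<lambda>u. min s 1)"
        unfolding integral_open_interval_real
        by (rule Henstock_Kurzweil_Integration.integral_cong) (auto simp: g_def)
      finally show ?thesis using lr by (simp add: mult.commute)
    qed
    \<comment> \<open>Uses \<open>W / b = \<tau> + (W - \<tau> * b) / b\<close> and replaces
      \<open>g u - \<tau>\<close> by its positive part.\<close>
    have bound: "ereal (W / b) \<le> ereal \<tau> + ereal (1 / b) * enn2ereal (\<integral>\<^sup>+ x. ennreal (max 0 (cost x s - \<tau>)) \<partial>\<mu>)"
      for \<tau>
    proof -
      define N where "N = (\<integral>\<^sup>+ x. ennreal (max 0 (cost x s - \<tau>)) \<partial>\<mu>)"
      define h where "h = (\<lambda>u. max 0 (g u - \<tau>))"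
      have h_int: "h integrable_on {l<..<r}"
      proof (rule bounded_measurable_integrable_on)
        show "h \<in> borel_measurable borel" unfolding h_def by measurable
        show "\<bar>h u\<bar> \<le> 2 + \<bar>\<tau>\<bar>" for u using g_bdd[of u] by (auto simp: h_def)
        show "{l<..<r} \<subseteq> {l..r}" by auto
      qed simp
      have "W - \<tau> * b = integral {l..r} (\<lambda>u. g u - \<tau>)"
        unfolding W_def using gint lr by (subst integral_diff) (auto simp: mult.commute)
      \<comment> \<open>The open window lies inside \<open>{0<..<1}\<close>, where
        \<open>quantile\<close> is meaningful, even if \<open>l = 0\<close> or
        \<open>r = 1\<close>.\<close>
      also have "\<dots> = integral {l<..<r} (\<lambda>u. g u - \<tau>)" by (rule integral_open_interval_real)
      also have "\<dots> \<le> integral {l<..<r} h"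
      proof (rule integral_le[OF _ h_int])
        show "(\<lambda>u. g u - \<tau>) integrable_on {l<..<r}"
        proof (rule bounded_measurable_integrable_on)
          show "\<bar>g u - \<tau>\<bar> \<le> 2 + \<bar>\<tau>\<bar>" for u using g_bdd[of u] by auto
          show "{l<..<r} \<subseteq> {l..r}" by auto
        qed measurable
      qed (auto simp: h_def)
      finally have WH: "W - \<tau> * b \<le> integral {l<..<r} h" .
      have H0: "0 \<le> integral {l<..<r} h"
        by (intro Henstock_Kurzweil_Integration.integral_nonneg h_int) (auto simp: h_def)
      have "ennreal (integral {l<..<r} h) = (\<integral>\<^sup>+ u. ennreal (h u) * indicator {l<..<r} u \<partial>lborel)"
        by (rule nn_integral_has_integral_lebesgue'[symmetric])
           (auto simp: h_def intro!: integrable_integral h_int[unfolded h_def])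
      also have "\<dots> \<le> (\<integral>\<^sup>+ u. ennreal (max 0 (cost (quantile \<mu> u) s - \<tau>)) * indicator {0<..<1} u \<partial>lborel)"
      proof (intro nn_integral_mono)
        fix u
        show "ennreal (h u) * indicator {l<..<r} u
            \<le> ennreal (max 0 (cost (quantile \<mu> u) s - \<tau>)) * indicator {0<..<1} u"
        proof (cases "u \<in> {l<..<r}")
          case True
          then have "u \<in> {0<..<1}" using lr by auto
          then show ?thesis using g_cost[of u] True by (auto simp: h_def intro!: ennreal_leI)
        qed simp
      qed
      also have "\<dots> = (\<integral>\<^sup>+ x. ennreal (max 0 (cost x s - \<tau>)) \<partial>distr unit_uniform borel (quantile \<mu>))"
        by (rule nn_integral_distr_unit_uniform[symmetric, OF quantile_measurable]) measurable
      also have "\<dots> = N" unfolding distr_quantile N_def ..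
      finally have "ereal (integral {l<..<r} h) \<le> enn2ereal N"
        using H0 by (metis enn2ereal_ennreal less_eq_ennreal.rep_eq)
      then have "ereal (W - \<tau> * b) \<le> enn2ereal N"
        using WH by (meson ereal_less_eq(3) order_trans)
      then have "ereal \<tau> + ereal (1 / b) * ereal (W - \<tau> * b) \<le> ereal \<tau> + ereal (1 / b) * enn2ereal N"
        using b by (intro add_left_mono ereal_mult_left_mono) auto
      moreover have "ereal \<tau> + ereal (1 / b) * ereal (W - \<tau> * b) = ereal (W / b)"
        using b by (simp add: field_simps)
      ultimately show ?thesis unfolding N_def by simp
    qed
    have "ereal (W / b) \<le> CVaR \<delta> \<mu> (\<lambda>x. cost x s)"
      unfolding CVaR_def b_def[symmetric] by (rule INF_greatest) (rule bound)
    also have "\<dots> \<le> ereal (min s 1) * ereal A"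
    proof -
      have "ratio_at \<delta> \<mu> s \<le> ereal A"
        using ratio s0 unfolding ratio_def by (auto simp: SUP_le_iff)
      then show ?thesis
        unfolding ratio_at_def using s0 by (subst (asm) ereal_divide_le_pos) (auto simp flip: ereal_min)
    qed
    finally have "W / b \<le> min s 1 * A" by (simp flip: ereal_min)
    then have "W \<le> min s 1 * A * b" using b by (simp add: field_simps)
    then show ?thesis unfolding W by (simp add: algebra_simps)
  qed
  have "((\<lambda>s. ((A - 1) * b + min t b) * min s 1) \<longlongrightarrow> ((A - 1) * b + min t b) * min (quantile \<mu> t) 1)
      (at_right (quantile \<mu> t))"
    by (intro tendsto_intros)
  then have "min t b + J \<le> ((A - 1) * b + min t b) * min (quantile \<mu> t) 1"
    by (rule tendsto_lowerbound) (auto simp: eventually_at_filter intro!: at_s always_eventually)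
  then show ?thesis
    using t01 by (simp add: capped_quantile_def b_def[symmetric] J_def l_def)
qed

end

subsection \<open>The optimal strategy\<close>

context delay
begin

context
  fixes \<phi> :: "real \<Rightarrow> real"
  assumes sol: "solves_dde \<delta> \<alpha> \<phi>"
begin

lemma phi_0: "\<phi> 0 = 0"
  using sol b by (auto simp: solves_iff)

lemma phi_less: "0 \<le> u \<Longrightarrow> u < v \<Longrightarrow> v \<le> 1 \<Longrightarrow> \<phi> u < \<phi> v"
  using strict_mono_onD[OF solves_strict_mono[OF sol], of u v] by auto

lemma phi_le: "0 \<le> u \<Longrightarrow> u \<le> v \<Longrightarrow> v \<le> 1 \<Longrightarrow> \<phi> u \<le> \<phi> v"
  using phi_less[of u v] by (cases "u = v") auto

lemma phi_tendsto_1: "(\<phi> \<longlongrightarrow> \<phi> 1) (at_left 1)"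
  using continuous_on_Icc_at_leftD[OF solves_continuous[OF sol]] by simp

lemma phi_integrable: "0 \<le> u \<Longrightarrow> v \<le> 1 \<Longrightarrow> \<phi> integrable_on {u..v}"
  by (intro integrable_continuous_real continuous_on_subset[OF solves_continuous[OF sol]]) auto

lemma phi_measurable: "\<phi> \<in> borel_measurable unit_uniform"
  by (intro continuous_measurable_unit_uniform solves_continuous sol)

lemma phi_strategy: "distr unit_uniform borel \<phi> \<in> strategies"
  using phi_le[of 0] by (intro distr_in_strategies phi_measurable) (auto simp: phi_0)

lemma integral_gap:
  assumes \<nu>: "\<nu> \<in> strategies" and u: "0 \<le> u" "v \<le> 1"
  shows "integral {u..v} (\<lambda>t. capped_quantile \<nu> t - \<phi> t)
    = integral {u..v} (capped_quantile \<nu>) - integral {u..v} \<phi>"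
  by (intro integral_diff capped_quantile_integrable[OF \<nu>] phi_integrable u)

text \<open>Subtracting the identity \<open>solves_integral\<close> from
  \<open>capped_quantile_ineq\<close> cancels the terms \<open>min t b\<close>; the excess
  \<open>\<epsilon>\<close> contributes at most \<open>\<epsilon> * b\<close> because capped
  quantiles are at most \<open>1\<close>.\<close>

lemma gap_ineq:
  assumes \<nu>: "\<nu> \<in> strategies" and ratio: "ratio \<delta> \<nu> \<le> ereal (\<alpha> + \<epsilon>)" and \<epsilon>: "0 \<le> \<epsilon>"
    and t: "t \<in> {0..<1}"
  shows "integral {max 0 (t - b)..t} (\<lambda>t. capped_quantile \<nu> t - \<phi> t) - \<epsilon> * b
    \<le> (c + min t b) * (capped_quantile \<nu> t - \<phi> t)"
proof -
  have "min t b + integral {max 0 (t - b)..t} (capped_quantile \<nu>)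
      \<le> ((\<alpha> + \<epsilon> - 1) * b + min t b) * capped_quantile \<nu> t"
    using capped_quantile_ineq[OF \<nu> delta ratio t] by (simp add: b_def)
  also have "\<dots> = (c + min t b) * capped_quantile \<nu> t + \<epsilon> * b * capped_quantile \<nu> t"
    by (simp add: c_def algebra_simps)
  also have "\<dots> \<le> (c + min t b) * capped_quantile \<nu> t + \<epsilon> * b * 1"
    using \<epsilon> b capped_quantile_bounds[OF \<nu>] by (intro add_left_mono mult_left_mono) auto
  finally show ?thesis
    using solves_integral[OF sol, of t] t
    by (subst integral_gap[OF \<nu>]) (auto simp: right_diff_distrib)
qed

text \<open>The error is linear in \<open>\<epsilon>\<close> with a factor independent of
  \<open>\<nu>\<close> and \<open>t\<close>, so near-optimal strategies can be used in a
  limit.\<close>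

lemma phi_le_capped_quantile:
  assumes \<nu>: "\<nu> \<in> strategies" and ratio: "ratio \<delta> \<nu> \<le> ereal (\<alpha> + \<epsilon>)" and \<epsilon>: "0 \<le> \<epsilon>"
    and t: "t \<in> {0..<1}"
  shows "\<phi> t - 2 * (\<epsilon> * b) / c * exp (2 / c) \<le> capped_quantile \<nu> t"
proof -
  have "- (2 * (\<epsilon> * b) / c * exp (2 / c)) \<le> capped_quantile \<nu> t - \<phi> t"
  \<comment> \<open>The comparison runs on \<open>[0, t]\<close> with \<open>t < 1\<close>, because
    the capped quantile is set to \<open>0\<close> at level \<open>1\<close>.\<close>
  proof (rule window_comparison[OF c b(1), where k = "\<lambda>t. c + min t b" and x = t
        and D = "\<lambda>t. capped_quantile \<nu> t - \<phi> t" and A = "\<epsilon> * b" and M = "1 + \<phi> 1"])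
    show "(\<lambda>t. capped_quantile \<nu> t - \<phi> t) integrable_on {0..t}"
      using t by (intro integrable_diff capped_quantile_integrable[OF \<nu>] phi_integrable) auto
    fix u assume u: "u \<in> {0..t}"
    show "integral {max 0 (u - b)..u} (\<lambda>t. capped_quantile \<nu> t - \<phi> t) - \<epsilon> * b
        \<le> (c + min u b) * (capped_quantile \<nu> u - \<phi> u)"
      using u t by (intro gap_ineq \<nu> ratio \<epsilon>) auto
    show "\<bar>capped_quantile \<nu> u - \<phi> u\<bar> \<le> 1 + \<phi> 1"
      using capped_quantile_bounds[OF \<nu>, of u] phi_le[of 0 u] phi_le[of u 1] u t phi_0 by auto
    show "c \<le> c + min u b" using u b by auto
  qed (use t \<epsilon> b in auto)
  then show ?thesis by simp
qed

text \<open>Attainment of the infimum is not known at this point, so strategies of ratio below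
  \<open>\<alpha> + e / K\<close> are used: their capped quantiles are at most \<open>1\<close> and
  dominate \<open>\<phi>\<close> up to \<open>e\<close>. Continuity covers the endpoint.\<close>

lemma phi_1_le_if_optimal:
  assumes opt: "ereal \<alpha> = optimal_ratio \<delta>"
  shows "\<phi> 1 \<le> 1"
proof -
  define K where "K = 2 * b / c * exp (2 / c)"
  have K: "0 < K" using b c by (simp add: K_def)
  have "\<phi> t \<le> 1" if t: "t \<in> {0..<1}" for t
  proof (rule field_le_epsilon)
    fix e :: real assume e: "0 < e"
    have "optimal_ratio \<delta> < ereal (\<alpha> + e / K)" using e K by (simp flip: opt)
    then obtain \<nu> where \<nu>: "\<nu> \<in> strategies" "ratio \<delta> \<nu> < ereal (\<alpha> + e / K)"
      unfolding optimal_ratio_def by (auto simp: INF_less_iff)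
    then have "\<phi> t - 2 * (e / K * b) / c * exp (2 / c) \<le> capped_quantile \<nu> t"
      using e K t by (intro phi_le_capped_quantile) auto
    also have "2 * (e / K * b) / c * exp (2 / c) = e / K * K"
      using K by (simp add: K_def)
    finally show "\<phi> t \<le> 1 + e"
      using K capped_quantile_bounds(2)[OF \<nu>(1), of t] by simp
  qed
  then have "eventually (\<lambda>t. \<phi> t \<le> 1) (at_left 1)"
    using eventually_at_left_real[of 0 "1::real"] by (auto elim: eventually_mono)
  then show ?thesis
    by (intro tendsto_upperbound[OF phi_tendsto_1]) auto
qed

lemma ratio_phi_le:
  assumes "\<phi> 1 \<le> 1"
  shows "ratio \<delta> (distr unit_uniform borel \<phi>) \<le> ereal \<alpha>"
proof (rule ratio_distr_le)
  fix t :: real assume "t \<in> {0<..1}"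
  then show "min t (1 - \<delta>) + integral {max 0 (t - (1 - \<delta>))..t} \<phi>
      \<le> ((\<alpha> - 1) * (1 - \<delta>) + min t (1 - \<delta>)) * \<phi> t"
    using solves_integral[OF sol, of t] by (simp add: b_def c_def)
qed (use delta alpha assms phi_0 in \<open>auto intro: solves_continuous solves_strict_mono sol\<close>)

text \<open>If \<open>\<phi> 1 < 1\<close>, the dilation by \<open>r = 1 / \<phi> 1\<close> still
  stays within \<open>[0, 1]\<close>. It scales every term of the integral identity except
  \<open>min t b\<close>, which leaves the slack \<open>(r - 1) * min t b\<close>. This pays for a
  ratio of at most \<open>\<alpha> - e\<close>, contradicting the infimum.\<close>

lemma phi_1_eq_if_optimal:
  assumes opt: "ereal \<alpha> = optimal_ratio \<delta>"
  shows "\<phi> 1 = 1"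
proof (rule ccontr)
  assume "\<phi> 1 \<noteq> 1"
  then have less: "\<phi> 1 < 1" using phi_1_le_if_optimal[OF opt] by simp
  have pos: "0 < \<phi> 1" using phi_less[of 0 1] phi_0 by simp
  define r where "r = 1 / \<phi> 1"
  have r: "1 < r" using less pos by (simp add: r_def)
  \<comment> \<open>\<open>1 / c\<close> bounds the slope of the logarithm on \<open>[0, b]\<close>;
    \<open>1 / b\<close> makes \<open>C * b \<ge> 1\<close>, which suffices beyond
    \<open>b\<close>.\<close>
  define C where "C = 1 / c + 1 / b"
  have C: "0 < C" using b c by (simp add: C_def add_pos_pos)
  have linear: "\<phi> t \<le> C * min t b" if t: "t \<in> {0..1}" for t
  proof (cases "t \<le> b")
    case True
    then have "\<phi> t = ln (1 + t / c)" using sol t by (auto simp: solves_iff)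
    also have "\<dots> \<le> t / c" using t c by (intro ln_add_one_self_le_self) auto
    also have "\<dots> \<le> C * t" using t b by (simp add: C_def algebra_simps)
    finally show ?thesis using True by simp
  next
    case False
    have "\<phi> t \<le> 1" using phi_le[of t 1] t less by auto
    also have "\<dots> \<le> C * b" using b c by (simp add: C_def algebra_simps)
    finally show ?thesis using False by simp
  qed
  \<comment> \<open>The first entry lets the slack cover the loss
    \<open>e * r * b * \<phi> t\<close>; the second keeps \<open>\<alpha> - e\<close> nonnegative,
    as \<open>ratio_distr_le\<close> requires.\<close>
  define e where "e = min ((r - 1) / (r * b * C)) \<alpha>"
  have e: "0 < e" "e \<le> \<alpha>" "e * (r * b * C) \<le> r - 1"
  proof -
    have "0 < r * b * C" using r b C by simp
    then show "0 < e" "e * (r * b * C) \<le> r - 1"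
      using r alpha by (simp_all add: e_def flip: pos_le_divide_eq)
  qed (simp add: e_def)
  let ?q = "\<lambda>t. r * \<phi> t"
  have "ratio \<delta> (distr unit_uniform borel ?q) \<le> ereal (\<alpha> - e)"
  proof (rule ratio_distr_le[OF delta])
    show "continuous_on {0..1} ?q" by (intro continuous_intros solves_continuous sol)
    show "strict_mono_on {0..1} ?q" using r by (auto intro!: strict_mono_onI phi_less)
    show "?q 0 = 0" "?q 1 \<le> 1" using pos by (auto simp: phi_0 r_def)
    fix t :: real assume t: "t \<in> {0<..1}"
    let ?m = "min t b"
    have "e * r * b * \<phi> t \<le> e * r * b * (C * ?m)"
      using linear[of t] t e r b by (intro mult_left_mono) auto
    also have "\<dots> = e * (r * b * C) * ?m" by simp
    also have "\<dots> \<le> (r - 1) * ?m" using t b e by (intro mult_right_mono) auto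
    finally have "e * r * b * \<phi> t \<le> (r - 1) * ?m" .
    moreover have "r * integral {max 0 (t - b)..t} \<phi> = r * ((c + ?m) * \<phi> t - ?m)"
      using solves_integral[OF sol, of t] t by simp
    ultimately have "?m + r * integral {max 0 (t - b)..t} \<phi> \<le> ((\<alpha> - e - 1) * b + ?m) * (r * \<phi> t)"
      by (simp add: c_def algebra_simps)
    then show "min t (1 - \<delta>) + integral {max 0 (t - (1 - \<delta>))..t} ?q
        \<le> ((\<alpha> - e - 1) * (1 - \<delta>) + min t (1 - \<delta>)) * ?q t"
      by (simp add: b_def)
  qed (use e in simp)
  moreover have "distr unit_uniform borel ?q \<in> strategies"
    using phi_le[of 0] r phi_measurable by (intro distr_in_strategies) (auto simp: phi_0)
  ultimately have "optimal_ratio \<delta> \<le> ereal (\<alpha> - e)"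
    unfolding optimal_ratio_def by (rule INF_lower2[rotated])
  then show False using e by (simp flip: opt)
qed

text \<open>A gap at \<open>u\<close> propagates to the right by less than the window length; since there is no gap
  at \<open>1\<close>, it can be excluded going backwards in steps of length \<open>b\<close>.\<close>

lemma capped_quantile_eq_phi:
  assumes \<nu>: "\<nu> \<in> strategies" and ratio: "ratio \<delta> \<nu> \<le> ereal \<alpha>" and phi_1: "\<phi> 1 = 1"
    and u: "u \<in> {0<..<1}"
  shows "capped_quantile \<nu> u = \<phi> u"
proof -
  define D where "D = (\<lambda>t. capped_quantile \<nu> t - \<phi> t)"
  have D0: "0 \<le> D t" if "t \<in> {0..<1}" for t
    using phi_le_capped_quantile[OF \<nu>, of 0 t] ratio that by (simp add: D_def)
  have ineq: "integral {max 0 (t - b)..t} D \<le> (c + min t b) * D t" if "t \<in> {0..<1}" for t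
    using gap_ineq[OF \<nu>, of 0 t] ratio that by (simp add: D_def)
  have D_int: "D integrable_on {x..y}" if "0 \<le> x" "y \<le> 1" for x y
    unfolding D_def using that
    by (intro integrable_diff capped_quantile_integrable[OF \<nu>] phi_integrable)
  \<comment> \<open>Continuity of \<open>\<phi>\<close> and monotonicity of the capped quantile keep
    \<open>D\<close> above half of \<open>D u\<close> on some \<open>[u, r]\<close>. Every window
    ending in \<open>[r, u + b]\<close> contains this interval, so \<open>ineq\<close> yields a
    uniform lower bound \<open>\<eta>\<close>.\<close>
  have spread: "\<exists>r \<eta>. u < r \<and> r < 1 \<and> r < u + b \<and> 0 < \<eta> \<and>
      (\<forall>t. r \<le> t \<and> t \<le> u + b \<and> t < 1 \<longrightarrow> \<eta> \<le> (c + min t b) * D t)"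
    if u: "u \<in> {0<..<1}" and pos: "D u \<noteq> 0" for u
  proof -
    have Du: "0 < D u" using D0[of u] pos u by auto
    then obtain d where d: "0 < d"
      "\<And>w. w \<in> {0..1} \<Longrightarrow> dist w u < d \<Longrightarrow> dist (\<phi> w) (\<phi> u) < D u / 2"
      using solves_continuous[OF sol] u unfolding continuous_on_iff
      by (metis atLeastAtMost_iff greaterThanLessThan_iff half_gt_zero less_eq_real_def)
    define r where "r = Min {u + d / 2, (u + 1) / 2, u + b / 2}"
    have r: "u < r" "r < 1" "r < u + b" "r < u + d"
      using u d b by (auto simp: r_def min_def)
    have near: "D u / 2 \<le> D w" if w: "w \<in> {u..r}" for w
      using d(2)[of w] w r u capped_quantile_mono[OF \<nu>, of u w] by (auto simp: D_def dist_real_def abs_if split: if_splits)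
    have "D u / 2 * (r - u) \<le> (c + min t b) * D t" if t: "r \<le> t" "t \<le> u + b" "t < 1" for t
    proof -
      have "D u / 2 * (r - u) = integral {u..r} (\<lambda>_. D u / 2)" using r by simp
      also have "\<dots> \<le> integral {u..r} D"
        using near r u by (intro integral_le D_int) auto
      also have "\<dots> \<le> integral {max 0 (t - b)..t} D"
        using r u t b by (intro integral_subset_le D_int ballI D0) auto
      also have "\<dots> \<le> (c + min t b) * D t" using t r u by (intro ineq) auto
      finally show ?thesis .
    qed
    moreover have "0 < D u / 2 * (r - u)" using Du r by simp
    ultimately show ?thesis using r by blast
  qed
  \<comment> \<open>Here \<open>u + b > 1\<close>, so the gap would persist up to level
    \<open>1\<close>, while \<open>D t \<le> 1 - \<phi> t\<close> tends to \<open>0\<close>.\<close>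
  have base: "D u = 0" if u: "u \<in> {0<..<1}" "1 - b < u" for u
  proof (rule ccontr)
    assume "D u \<noteq> 0"
    from spread[OF u(1) this] obtain r \<eta> where r: "u < r" "r < 1" "0 < \<eta>"
      "\<And>t. r \<le> t \<Longrightarrow> t \<le> u + b \<Longrightarrow> t < 1 \<Longrightarrow> \<eta> \<le> (c + min t b) * D t"
      by metis
    have "\<eta> \<le> (c + b) * (1 - \<phi> t)" if t: "t \<in> {r<..<1}" for t
    proof -
      have "\<eta> \<le> (c + min t b) * D t" using r t u by auto
      also have "\<dots> \<le> (c + b) * (1 - \<phi> t)"
        using capped_quantile_bounds[OF \<nu>, of t] D0[of t] t r u c b
        by (intro mult_mono) (auto simp: D_def)
      finally show ?thesis .
    qed
    then have "eventually (\<lambda>t. \<eta> \<le> (c + b) * (1 - \<phi> t)) (at_left 1)"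
      using eventually_at_left_real[OF r(2)] by (auto elim: eventually_mono)
    moreover have "((\<lambda>t. (c + b) * (1 - \<phi> t)) \<longlongrightarrow> (c + b) * (1 - \<phi> 1)) (at_left 1)"
      by (intro tendsto_intros phi_tendsto_1)
    ultimately have "\<eta> \<le> (c + b) * (1 - \<phi> 1)"
      by (intro tendsto_lowerbound) auto
    then show False using r phi_1 by simp
  qed
  have vanish: "\<forall>u\<in>{0<..<1}. 1 - real (Suc n) * b < u \<longrightarrow> D u = 0" for n
  proof (induction n)
    case 0
    then show ?case using base by simp
  next
    case (Suc n)
    show ?case
    proof (intro ballI impI, rule ccontr)
      fix u assume u: "u \<in> {0<..<1}" "1 - real (Suc (Suc n)) * b < u" and "D u \<noteq> 0"
      from spread[OF u(1) this(3)] obtain r \<eta> where r: "u < r" "r < 1" "r < u + b" "0 < \<eta>"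
        "\<And>t. r \<le> t \<Longrightarrow> t \<le> u + b \<Longrightarrow> t < 1 \<Longrightarrow> \<eta> \<le> (c + min t b) * D t"
        by metis
      have "0 < real (Suc n) * b" using b by simp
      moreover have "1 - real (Suc n) * b < u + b" using u(2) by (simp add: algebra_simps)
      ultimately have "max r (1 - real (Suc n) * b) < min 1 (u + b)"
        using r by simp
      \<comment> \<open>A level reached from \<open>u\<close> that also lies in the range cleared by
        the induction hypothesis.\<close>
      then obtain t where t: "max r (1 - real (Suc n) * b) < t" "t < min 1 (u + b)"
        using dense by blast
      then have "D t = 0" using Suc.IH r(1) u(1) by auto
      then show False using r(4) r(5)[of t] t by auto
    qed
  qed
  obtain n :: nat where "1 / b \<le> real n" using real_arch_simple by blast
  then have "1 - real (Suc n) * b < u" using b u by (simp add: field_simps)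
  then show ?thesis using vanish[of n] u by (simp add: D_def)
qed

text \<open>Below level \<open>1\<close> the cap is inactive:
  \<open>\<phi> u < \<phi> 1 = 1\<close>, so a capped quantile equal to \<open>\<phi> u\<close> is
  the quantile itself, which determines the law.\<close>

lemma optimal_unique:
  assumes \<nu>: "\<nu> \<in> strategies" and ratio: "ratio \<delta> \<nu> \<le> ereal \<alpha>" and phi_1: "\<phi> 1 = 1"
  shows "\<nu> = distr unit_uniform borel \<phi>"
proof -
  have "quantile \<nu> u = \<phi> u" if u: "u \<in> {0<..<1}" for u
    using capped_quantile_eq_phi[OF \<nu> ratio phi_1 u] phi_less[of u 1] phi_1 u
    by (auto simp: capped_quantile_def min_def split: if_splits)
  then have "distr unit_uniform borel (quantile \<nu>) = distr unit_uniform borel \<phi>"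
    by (intro distr_cong) (auto simp: space_restrict_space)
  then show ?thesis using distr_quantile[OF \<nu>] by simp
qed

section \<open>The law with quantile function \<open>\<phi>\<close> and its inverse distribution
  function\<close>

lemma cdf_distr_phi:
  assumes v: "v \<in> {0..1}"
  shows "cdf (distr unit_uniform borel \<phi>) (\<phi> v) = v"
proof -
  have iff: "\<phi> u \<le> \<phi> v \<longleftrightarrow> u \<le> v" if "u \<in> {0<..<1}" for u
    using strict_mono_on_less_eq[OF solves_strict_mono[OF sol], of u v] that v by auto
  have "cdf (distr unit_uniform borel \<phi>) (\<phi> v) = measure unit_uniform {u \<in> {0<..<1}. \<phi> u \<le> \<phi> v}"
    unfolding cdf_def
    by (subst measure_distr[OF phi_measurable])
       (auto simp: space_restrict_space intro!: arg_cong2[where f = measure])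
  also have "{u \<in> {0<..<1}. \<phi> u \<le> \<phi> v} = (if v < 1 then {0<..v} else {0<..<1})"
    using iff v by auto
  also have "measure unit_uniform \<dots> = v"
    using v by (auto simp: measure_restrict_space subset_eq)
  finally show ?thesis .
qed

text \<open>By the intermediate value theorem \<open>\<phi>\<close> maps onto \<open>[0, 1]\<close>,
  so every \<open>x\<close> there is some \<open>\<phi> v\<close> and has cdf \<open>v\<close>. The
  infimum is thus taken over \<open>{\<phi> t..1}\<close>.\<close>

lemma inverse_cdf_distr_phi:
  assumes phi_1: "\<phi> 1 = 1" and t: "t \<in> {0..1}"
  shows "inverse_cdf 0 1 (distr unit_uniform borel \<phi>) t = \<phi> t"
proof -
  have "cdf (distr unit_uniform borel \<phi>) x \<ge> t \<longleftrightarrow> \<phi> t \<le> x" if x: "x \<in> {0..1}" for x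
  proof -
    obtain v where v: "0 \<le> v" "v \<le> 1" "\<phi> v = x"
      using IVT'[of \<phi> 0 x 1] solves_continuous[OF sol] x phi_0 phi_1 by auto
    then have "cdf (distr unit_uniform borel \<phi>) x = v" using cdf_distr_phi[of v] by auto
    then show ?thesis
      using strict_mono_on_less_eq[OF solves_strict_mono[OF sol], of t v] v t by auto
  qed
  then have "{x \<in> {0..1}. cdf (distr unit_uniform borel \<phi>) x \<ge> t} = {\<phi> t..1}"
    using phi_le[of 0 t] t phi_0 by auto
  then show ?thesis
    unfolding inverse_cdf_def using phi_le[of t 1] t phi_1 by simp
qed

lemma optimal_strategy_phi:
  assumes opt: "ereal \<alpha> = optimal_ratio \<delta>"
  shows "optimal_strategy \<delta> (distr unit_uniform borel \<phi>)"
  unfolding optimal_strategy_def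
proof
  show "ratio \<delta> (distr unit_uniform borel \<phi>) = optimal_ratio \<delta>"
  proof (rule antisym)
    show "ratio \<delta> (distr unit_uniform borel \<phi>) \<le> optimal_ratio \<delta>"
      using ratio_phi_le phi_1_le_if_optimal[OF opt] by (simp flip: opt)
    show "optimal_ratio \<delta> \<le> ratio \<delta> (distr unit_uniform borel \<phi>)"
      unfolding optimal_ratio_def by (intro INF_lower phi_strategy)
  qed
qed (rule phi_strategy)

end

end

theorem theorem2:
  fixes \<delta> \<alpha> :: real
  assumes "0 \<le> \<delta>" and "\<delta> < 1" and "1 < \<alpha>"
  shows "\<exists>\<phi>. solves_dde \<delta> \<alpha> \<phi> \<and>
           (\<forall>\<psi>. solves_dde \<delta> \<alpha> \<psi> \<longrightarrow> (\<forall>t\<in>{0..1}. \<psi> t = \<phi> t)) \<and>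
           (ereal \<alpha> = optimal_ratio \<delta> \<longrightarrow>
              (\<forall>t\<in>{0..1}. \<phi> t \<in> {0..1}) \<and>
              (\<exists>\<mu>. optimal_strategy \<delta> \<mu> \<and>
                   (\<forall>\<nu>. optimal_strategy \<delta> \<nu> \<longrightarrow> \<nu> = \<mu>) \<and>
                   (AE x in \<mu>. x \<in> {0..1}) \<and>
                   (\<forall>t\<in>{0..1}. \<phi> t = inverse_cdf 0 1 \<mu> t)))"
proof -
  interpret delay \<delta> \<alpha> using assms by unfold_locales
  obtain \<phi> where sol: "solves_dde \<delta> \<alpha> \<phi>" using solution_exists by blast
  show ?thesis
  proof (intro exI[of _ \<phi>] conjI allI impI)
    show "\<forall>t\<in>{0..1}. \<psi> t = \<phi> t" if "solves_dde \<delta> \<alpha> \<psi>" for \<psi>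
      using solves_unique[OF sol that] by simp
    assume opt: "ereal \<alpha> = optimal_ratio \<delta>"
    note phi_1 = phi_1_eq_if_optimal[OF sol opt]
    show range: "\<forall>t\<in>{0..1}. \<phi> t \<in> {0..1}"
      using phi_le[OF sol, of 0] phi_le[OF sol, of _ 1] phi_0[OF sol] phi_1 by auto
    let ?\<mu> = "distr unit_uniform borel \<phi>"
    show "\<exists>\<mu>. optimal_strategy \<delta> \<mu> \<and> (\<forall>\<nu>. optimal_strategy \<delta> \<nu> \<longrightarrow> \<nu> = \<mu>) \<and>
        (AE x in \<mu>. x \<in> {0..1}) \<and> (\<forall>t\<in>{0..1}. \<phi> t = inverse_cdf 0 1 \<mu> t)"
    proof (intro exI[of _ ?\<mu>] conjI allI impI)
      show "optimal_strategy \<delta> ?\<mu>" by (rule optimal_strategy_phi[OF sol opt])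
      show "\<nu> = ?\<mu>" if "optimal_strategy \<delta> \<nu>" for \<nu>
        using that optimal_unique[OF sol _ _ phi_1] by (simp add: optimal_strategy_def flip: opt)
      show "AE x in ?\<mu>. x \<in> {0..1}"
        using range by (subst AE_distr_iff[OF phi_measurable[OF sol]])
          (auto simp: space_restrict_space intro!: AE_I2)
      show "\<forall>t\<in>{0..1}. \<phi> t = inverse_cdf 0 1 ?\<mu> t"
        using inverse_cdf_distr_phi[OF sol phi_1] by simp
    qed
  qed (rule sol)
qed

end
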